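(* Let $K$ be a field with $\mathrm{char}(K)\ne2,3$, $\Delta\in K^*$, and $g_1,g_2$ binary cubic forms over $K$ of discriminant $\Delta$, with common resolvent algebra $L=K[\delta]$. Then: (1) $g_2=g_1^M$ for some $M\in\mathrm{GL}(2,K)$ with $\det(M)=+1$ if and only if $z(g_1)=z(g_2)$ in $L^*/L^{*3}$; (2) $g_2=g_1^M$ for some $M\in\mathrm{GL}(2,K)$ with $\det(M)=-1$ if and only if $z(g_1)=z(g_2)^{-1}$ in $L^*/L^{*3}$. Hence $g_1$ and $g_2$ are $\mathrm{GL}(2,K)$-equivalent if and only if $z(g_1)$ and $z(g_2)$ generate the same subgroup of $L^*/L^{*3}$.
   Context: For $g=aX^3+bX^2Y+cXY^2+dY^3$: discriminant $b^2c^2-4ac^3-4b^3d-27a^2d^2+18abcd$; cubic covariant $G(X,Y)=(2b^3+27a^2d-9abc)X^3+3(b^2c+9abd-6ac^2)X^2Y-3(bc^2+9acd-6b^2d)XY^2-(2c^3+27ad^2-9bcd)Y^3$. Twisted action: $g^M(X,Y)=\det(M)^{-1}g(rX+tY,sX+uY)$ for $M=\begin{pmatrix}r&s\\t&u\end{pmatrix}$. Resolvent algebra $L=K[T]/(T^2+3\Delta)$, $\delta$ the image of $T$ (fixed for all forms of discriminant $\Delta$), $L^*$ its unit group. Cardano covariant $C=\tfrac12(G+3\delta g)$; Cardano invariant $z(g)$ = class in $L^*/L^{*3}$ of $C(x,y)$ for any $x,y\in K$ with $C(x,y)\in L^*$ (independent of the choice). *)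

theory Defs
  imports
    "HOL-Analysis.Analysis"
    "HOL-Algebra.Algebra"
    "HOL-Algebra.Algebraic_Closure_Type"
begin

text \<open>\<open>BCF a b c d\<close> is the form \<open>a X\<^sup>3 + b X\<^sup>2 Y + c X Y\<^sup>2 + d Y\<^sup>3\<close>, given by its
  coefficients.\<close>

datatype 'a bcf = BCF 'a 'a 'a 'a

fun bcf_eval :: "'a::comm_ring_1 bcf \<Rightarrow> 'a \<Rightarrow> 'a \<Rightarrow> 'a" where
  "bcf_eval (BCF a b c d) x y = a * x ^ 3 + b * x ^ 2 * y + c * x * y ^ 2 + d * y ^ 3"

fun bcf_disc :: "'a::comm_ring_1 bcf \<Rightarrow> 'a" where
  "bcf_disc (BCF a b c d) =
     b ^ 2 * c ^ 2 - 4 * a * c ^ 3 - 4 * b ^ 3 * d - 27 * a ^ 2 * d ^ 2 + 18 * a * b * c * d"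

fun cubic_covariant :: "'a::comm_ring_1 bcf \<Rightarrow> 'a bcf" where
  "cubic_covariant (BCF a b c d) =
     BCF (2 * b ^ 3 + 27 * a ^ 2 * d - 9 * a * b * c)
         (3 * (b ^ 2 * c + 9 * a * b * d - 6 * a * c ^ 2))
         (- 3 * (b * c ^ 2 + 9 * a * c * d - 6 * b ^ 2 * d))
         (- (2 * c ^ 3 + 27 * a * d ^ 2 - 9 * b * c * d))"

text \<open>Coefficients of \<open>g(rX + tY, sX + uY)\<close>; lemma \<open>bcf_poly_twist\<close> below confirms the
  expansion as an identity of polynomials in \<open>X\<close> and \<open>Y\<close>.\<close>

fun bcf_subst :: "'a::comm_ring_1 bcf \<Rightarrow> 'a \<Rightarrow> 'a \<Rightarrow> 'a \<Rightarrow> 'a \<Rightarrow> 'a bcf" where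
  "bcf_subst (BCF a b c d) r s t u =
     BCF (a * r ^ 3 + b * r ^ 2 * s + c * r * s ^ 2 + d * s ^ 3)
         (3 * a * r ^ 2 * t + b * (r ^ 2 * u + 2 * r * s * t)
            + c * (2 * r * s * u + s ^ 2 * t) + 3 * d * s ^ 2 * u)
         (3 * a * r * t ^ 2 + b * (2 * r * t * u + s * t ^ 2)
            + c * (r * u ^ 2 + 2 * s * t * u) + 3 * d * s * u ^ 2)
         (a * t ^ 3 + b * t ^ 2 * u + c * t * u ^ 2 + d * u ^ 3)"

definition bcf_twist :: "'a::field bcf \<Rightarrow> 'a ^ 2 ^ 2 \<Rightarrow> 'a bcf" where
  "bcf_twist g M = map_bcf (\<lambda>k. inverse (det M) * k)
     (bcf_subst g (M $ 1 $ 1) (M $ 1 $ 2) (M $ 2 $ 1) (M $ 2 $ 2))"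

text \<open>Forms as elements of \<open>K[X][Y]\<close>, used only to validate \<open>bcf_twist\<close>.\<close>

abbreviation bcf_const :: "'a::comm_ring_1 \<Rightarrow> 'a poly poly" where
  "bcf_const k \<equiv> [:[:k:]:]"

abbreviation bcf_X :: "'a::comm_ring_1 poly poly" where
  "bcf_X \<equiv> [:[:0, 1:]:]"

abbreviation bcf_Y :: "'a::comm_ring_1 poly poly" where
  "bcf_Y \<equiv> [:0, 1:]"

definition bcf_poly :: "'a::comm_ring_1 bcf \<Rightarrow> 'a poly poly" where
  "bcf_poly g = bcf_eval (map_bcf bcf_const g) bcf_X bcf_Y"

lemma bcf_poly_inj: "bcf_poly g = bcf_poly h \<longleftrightarrow> g = h"
  by (cases g; cases h) (auto simp: bcf_poly_def numeral_eq_Suc)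

lemma bcf_poly_twist:
  fixes g :: "'a::field bcf"
  shows "bcf_poly (bcf_twist g M) =
    bcf_const (inverse (det M)) *
    bcf_eval (map_bcf bcf_const g)
      (bcf_const (M $ 1 $ 1) * bcf_X + bcf_const (M $ 2 $ 1) * bcf_Y)
      (bcf_const (M $ 1 $ 2) * bcf_X + bcf_const (M $ 2 $ 2) * bcf_Y)"
  by (cases g) (simp add: bcf_poly_def bcf_twist_def numeral_eq_Suc algebra_simps)

text \<open>The resolvent algebra \<open>K[T]/(T\<^sup>2 + 3\<Delta>)\<close>, as a quotient of the polynomial ring
  over \<open>K\<close>.\<close>

abbreviation resolvent_ideal :: "'a::field \<Rightarrow> 'a poly set" where
  "resolvent_ideal \<Delta> \<equiv> PIdl\<^bsub>ring_of_type_algebra\<^esub> [:3 * \<Delta>, 0, 1:]"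

definition resolvent_algebra :: "'a::field \<Rightarrow> 'a poly set ring" where
  "resolvent_algebra \<Delta> = ring_of_type_algebra Quot resolvent_ideal \<Delta>"

definition resolvent_class :: "'a::field \<Rightarrow> 'a poly \<Rightarrow> 'a poly set" where
  "resolvent_class \<Delta> p = resolvent_ideal \<Delta> +>\<^bsub>ring_of_type_algebra\<^esub> p"

definition resolvent_const :: "'a::field \<Rightarrow> 'a \<Rightarrow> 'a poly set" where
  "resolvent_const \<Delta> k = resolvent_class \<Delta> [:k:]"

definition resolvent_delta :: "'a::field \<Rightarrow> 'a poly set" where
  "resolvent_delta \<Delta> = resolvent_class \<Delta> [:0, 1:]"

text \<open>The value at \<open>(x, y) \<in> K\<^sup>2\<close> of the Cardano covariant \<open>(G + 3\<delta>g)/2\<close>.\<close>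

definition cardano_covariant :: "'a::field \<Rightarrow> 'a bcf \<Rightarrow> 'a \<Rightarrow> 'a \<Rightarrow> 'a poly set" where
  "cardano_covariant \<Delta> g x y =
     (let L = resolvent_algebra \<Delta> in
      resolvent_const \<Delta> (1 / 2) \<otimes>\<^bsub>L\<^esub>
        (resolvent_const \<Delta> (bcf_eval (cubic_covariant g) x y) \<oplus>\<^bsub>L\<^esub>
         resolvent_const \<Delta> 3 \<otimes>\<^bsub>L\<^esub> resolvent_delta \<Delta> \<otimes>\<^bsub>L\<^esub>
           resolvent_const \<Delta> (bcf_eval g x y)))"

definition resolvent_units :: "'a::field \<Rightarrow> 'a poly set monoid" where
  "resolvent_units \<Delta> = units_of (resolvent_algebra \<Delta>)"

definition resolvent_cubes :: "'a::field \<Rightarrow> 'a poly set set" where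
  "resolvent_cubes \<Delta> =
     (\<lambda>w. w [^]\<^bsub>resolvent_units \<Delta>\<^esub> (3::nat)) ` carrier (resolvent_units \<Delta>)"

definition units_mod_cubes :: "'a::field \<Rightarrow> 'a poly set set monoid" where
  "units_mod_cubes \<Delta> = resolvent_units \<Delta> Mod resolvent_cubes \<Delta>"

definition cardano_invariant :: "'a::field \<Rightarrow> 'a bcf \<Rightarrow> 'a poly set set" where
  "cardano_invariant \<Delta> g =
     (THE \<zeta>. \<exists>x y. cardano_covariant \<Delta> g x y \<in> carrier (resolvent_units \<Delta>) \<and>
        \<zeta> = resolvent_cubes \<Delta> #>\<^bsub>resolvent_units \<Delta>\<^esub> cardano_covariant \<Delta> g x y)"

end

theory Submission
  imports Defs
begin

text \<open>
  Let \<open>H\<close> be the polar form of the Hessian of \<open>g\<close>, write \<open>v \<and> w\<close> for the determinant of \<open>v\<close> and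
  \<open>w\<close>, and let \<open>\<^sup>*\<close> be the conjugation of \<open>L\<close>. Polarising the classical syzygy
  \<open>G\<^sup>2 + 27 \<Delta> g\<^sup>2 = 4 H\<^sup>3\<close> gives \<open>C(v) C(w)\<^sup>* = B(v, w)\<^sup>3\<close> with
  \<open>B(v, w) = H(v, w) + \<delta> (w \<and> v) / 2\<close>. For \<open>v = w\<close> this says that \<open>C(w)\<close> has norm \<open>H(w, w)\<^sup>3\<close>,
  and so \<open>C(v) = \<lambda>(v)\<^sup>3 C(w)\<close>, where \<open>\<lambda>(v) = B(v, w) / H(w, w)\<close> is a linear map from \<open>K\<^sup>2\<close> to \<open>L\<close>
  of determinant \<open>1 / (2 H(w, w))\<close>. In particular the class of \<open>C(v)\<close> does not depend on \<open>v\<close>.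
  A twist of determinant \<open>1\<close> or \<open>-1\<close> replaces \<open>C\<close> by \<open>C \<circ> M\<close> or its conjugate, and the
  conjugate represents the inverse class because the norm is a cube.

  Conversely, let \<open>C\<^sub>1(w\<^sub>1) = z\<^sup>3 C\<^sub>2(w\<^sub>2)\<close>. Then \<open>C\<^sub>1(v) = (z \<lambda>\<^sub>1(v))\<^sup>3 C\<^sub>2(w\<^sub>2) = C\<^sub>2(M v)\<close> for
  \<open>M = \<lambda>\<^sub>2\<^sup>-\<^sup>1 \<circ> z \<circ> \<lambda>\<^sub>1\<close>, and \<open>det M = N(z) H\<^sub>2 / H\<^sub>1\<close> is a cube root of unity, which becomes \<open>1\<close>
  when \<open>z\<close> is multiplied by a cube root of unity in \<open>K\<close>.
\<close>

lemma of_nat_prime_eq_0_iff: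
  assumes "Factorial_Ring.prime p"
  shows "of_nat p = (0 :: 'a::{semiring_1, zero_neq_one}) \<longleftrightarrow> CHAR('a) = p"
  using assms by (auto simp: of_nat_eq_0_iff_char_dvd prime_nat_iff)

lemma vec_2_eq_iff: "(v :: 'a ^ 2) = w \<longleftrightarrow> v $ 1 = w $ 1 \<and> v $ 2 = w $ 2"
  by (simp add: vec_eq_iff forall_2)

lemma vector_matrix_mult_2:
  fixes M :: "'a::comm_semiring_1 ^ 2 ^ 2"
  shows "(v v* M) $ j = M $ 1 $ j * v $ 1 + M $ 2 $ j * v $ 2"
  by (simp add: vector_matrix_mult_def sum_2 mult.commute)

subsection \<open>Groups of exponent three\<close>

lemma (in group) generate_singleton_if_pow_3_eq_one:
  assumes y: "y \<in> carrier G" and cube: "y [^] (3::nat) = \<one>"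
  shows "generate G {y} = {\<one>, y, inv y}"
proof
  have sq: "y \<otimes> y = inv y"
    using cube y by (intro inv_equality[symmetric]) (simp_all add: numeral_3_eq_3)
  then have "inv y \<otimes> inv y = y"
    using y by (metis inv_inv inv_mult_group)
  with sq have prods: "a \<otimes> b \<in> {\<one>, y, inv y}"
    if "a \<in> {\<one>, y, inv y}" "b \<in> {\<one>, y, inv y}" for a b
    using that y by auto
  show "generate G {y} \<subseteq> {\<one>, y, inv y}"
  proof
    show "x \<in> {\<one>, y, inv y}" if "x \<in> generate G {y}" for x
      using that by (induction rule: generate.induct) (use prods in auto)
  qed
qed (auto intro: generate.intros)

lemma (in group) generate_singleton_eq_iff_if_pow_3_eq_one:
  assumes y: "y \<in> carrier G" and cube: "y [^] (3::nat) = \<one>"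
  shows "generate G {x} = generate G {y} \<longleftrightarrow> x = y \<or> x = inv y"
proof
  assume eq: "generate G {x} = generate G {y}"
  then have "x \<in> {\<one>, y, inv y}"
    using generate.incl[of x "{x}" G] generate_singleton_if_pow_3_eq_one[OF y cube] by simp
  moreover have "y = \<one>" if "x = \<one>"
    using generate.incl[of y "{y}" G] eq generate_one that by auto
  ultimately show "x = y \<or> x = inv y"
    by auto
next
  have "generate G {inv y} = generate G {y}"
    using y cube by (auto simp: generate_singleton_if_pow_3_eq_one nat_pow_inv)
  moreover assume "x = y \<or> x = inv y"
  ultimately show "generate G {x} = generate G {y}"
    by auto
qed

subsection \<open>Binary cubic forms and their twists\<close>

abbreviation bcf_at :: "'a::comm_ring_1 bcf \<Rightarrow> 'a ^ 2 \<Rightarrow> 'a" where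
  "bcf_at g v \<equiv> bcf_eval g (v $ 1) (v $ 2)"

lemma bcf_eqI:
  fixes g h :: "'a::idom bcf"
  assumes two: "(2::'a) \<noteq> 0" and eq: "\<And>v. bcf_at g v = bcf_at h v"
  shows "g = h"
proof -
  obtain a b c d a' b' c' d' where gh: "g = BCF a b c d" "h = BCF a' b' c' d'"
    by (cases g; cases h)
  have ends: "a = a'" "d = d'"
    using eq[of "vector [1, 0]"] eq[of "vector [0, 1]"] by (simp_all add: gh)
  then have sum: "b + c = b' + c'" and diff: "b - c = b' - c'"
    using eq[of "vector [1, 1]"] eq[of "vector [1, -1]"] by (simp_all add: gh algebra_simps)
  have "2 * b = (b + c) + (b - c)" by simp
  also have "\<dots> = 2 * b'" unfolding sum diff by simp
  finally have "b = b'" using two by simp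
  then show ?thesis using ends sum by (simp add: gh)
qed

lemma bcf_disc_subst:
  fixes g :: "'a::idom bcf"
  shows "bcf_disc (bcf_subst g r s t u) = (r * u - s * t) ^ 6 * bcf_disc g"
  by (induct g) (simp, Groebner_Basis.algebra)

lemma cubic_covariant_subst:
  fixes g :: "'a::idom bcf"
  shows "cubic_covariant (bcf_subst g r s t u) =
     map_bcf (\<lambda>k. (r * u - s * t) ^ 3 * k) (bcf_subst (cubic_covariant g) r s t u)"
  by (induct g) (simp, intro conjI; Groebner_Basis.algebra)

lemma bcf_eval_subst:
  "bcf_eval (bcf_subst g r s t u) x y = bcf_eval g (r * x + t * y) (s * x + u * y)"
  by (cases g) (simp add: algebra_simps power2_eq_square power3_eq_cube)

lemma bcf_eval_scale: "bcf_eval (map_bcf (\<lambda>e. k * e) g) x y = k * bcf_eval g x y"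
  by (cases g) (simp add: algebra_simps)

lemma bcf_disc_scale: "bcf_disc (map_bcf (\<lambda>e. k * e) g) = k ^ 4 * bcf_disc g"
  by (cases g) (simp add: power_mult_distrib algebra_simps eval_nat_numeral)

lemma cubic_covariant_scale:
  "cubic_covariant (map_bcf (\<lambda>e. k * e) g) = map_bcf (\<lambda>e. k ^ 3 * e) (cubic_covariant g)"
  by (cases g) (simp add: algebra_simps power2_eq_square power3_eq_cube)

lemma bcf_subst_scale:
  "bcf_subst (map_bcf (\<lambda>e. k * e) g) r s t u = map_bcf (\<lambda>e. k * e) (bcf_subst g r s t u)"
  by (cases g) (simp add: algebra_simps)

lemma bcf_subst_subst:
  fixes g :: "'a::comm_ring_1 bcf"
  shows "bcf_subst (bcf_subst g r s t u) r' s' t' u' =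
     bcf_subst g (r' * r + s' * t) (r' * s + s' * u) (t' * r + u' * t) (t' * s + u' * u)"
  by (cases g) (simp add: algebra_simps power2_eq_square power3_eq_cube)

lemma bcf_twist_twist: "bcf_twist (bcf_twist g M) N = bcf_twist g (N ** M)"
proof -
  have "(N ** M) $ i $ j = N $ i $ 1 * M $ 1 $ j + N $ i $ 2 * M $ 2 $ j" for i j
    by (simp add: matrix_matrix_mult_def sum_2)
  then show ?thesis
    by (simp add: bcf_twist_def bcf_subst_scale bcf_subst_subst det_mul bcf.map_comp comp_def
        mult.assoc)
qed

lemma bcf_at_twist: "bcf_at (bcf_twist g M) v = inverse (det M) * bcf_at g (v v* M)"
  by (simp add: bcf_twist_def bcf_eval_scale bcf_eval_subst vector_matrix_mult_2)

lemma bcf_disc_twist: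
  assumes "det M \<noteq> 0"
  shows "bcf_disc (bcf_twist g M) = det M ^ 2 * bcf_disc g"
proof -
  have "bcf_disc (bcf_twist g M) = inverse (det M) ^ 4 * (det M ^ 6 * bcf_disc g)"
    by (simp add: bcf_twist_def bcf_disc_scale bcf_disc_subst det_2)
  also have "\<dots> = det M ^ 2 * bcf_disc g"
    using assms by (simp add: field_simps flip: power_add)
  finally show ?thesis .
qed

lemma bcf_at_cubic_covariant_twist:
  assumes "det M \<noteq> 0"
  shows "bcf_at (cubic_covariant (bcf_twist g M)) v = bcf_at (cubic_covariant g) (v v* M)"
proof -
  have "bcf_at (cubic_covariant (bcf_twist g M)) v
      = inverse (det M) ^ 3 * (det M ^ 3 * bcf_at (cubic_covariant g) (v v* M))"
    by (simp add: bcf_twist_def cubic_covariant_scale cubic_covariant_subst bcf_eval_scale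
        bcf_eval_subst vector_matrix_mult_2 flip: det_2)
  then show ?thesis
    using assms by (simp add: field_simps)
qed

subsection \<open>The resolvent algebra in coordinates\<close>

text \<open>A vector \<open>z\<close> stands for the element \<open>z\<^sub>1 + z\<^sub>2 \<delta>\<close> of \<open>L\<close>, where \<open>\<delta>\<^sup>2 = -3 \<Delta>\<close>.\<close>

definition res_mult :: "'a::comm_ring_1 \<Rightarrow> 'a ^ 2 \<Rightarrow> 'a ^ 2 \<Rightarrow> 'a ^ 2" where
  "res_mult \<Delta> z w = vector [z $ 1 * w $ 1 - 3 * \<Delta> * z $ 2 * w $ 2, z $ 1 * w $ 2 + z $ 2 * w $ 1]"

definition res_conj :: "'a::comm_ring_1 ^ 2 \<Rightarrow> 'a ^ 2" where
  "res_conj z = vector [z $ 1, - z $ 2]"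

definition res_norm :: "'a::comm_ring_1 \<Rightarrow> 'a ^ 2 \<Rightarrow> 'a" where
  "res_norm \<Delta> z = (z $ 1) ^ 2 + 3 * \<Delta> * (z $ 2) ^ 2"

definition res_cube :: "'a::comm_ring_1 \<Rightarrow> 'a ^ 2 \<Rightarrow> 'a ^ 2" where
  "res_cube \<Delta> z = res_mult \<Delta> z (res_mult \<Delta> z z)"

interpretation res_mult: abel_semigroup "res_mult \<Delta>" for \<Delta> :: "'a::comm_ring_1"
  by unfold_locales (simp_all add: res_mult_def vec_2_eq_iff algebra_simps)

lemma res_mult_scale:
  "res_mult \<Delta> (k *s z) w = k *s res_mult \<Delta> z w"
  "res_mult \<Delta> z (k *s w) = k *s res_mult \<Delta> z w"
  by (simp_all add: res_mult_def vec_2_eq_iff algebra_simps)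

lemma res_mult_of_scalar:
  "res_mult \<Delta> (vector [k, 0]) z = k *s z"
  "res_mult \<Delta> z (vector [k, 0]) = k *s z"
  by (simp_all add: res_mult_def vec_2_eq_iff)

lemma res_mult_conj: "res_mult \<Delta> z (res_conj z) = vector [res_norm \<Delta> z, 0]"
  by (simp add: res_mult_def res_conj_def res_norm_def vec_2_eq_iff algebra_simps
      power2_eq_square)

lemma res_norm_of_scalar: "res_norm \<Delta> (vector [k, 0]) = k ^ 2"
  by (simp add: res_norm_def)

lemma res_norm_conj [simp]: "res_norm \<Delta> (res_conj z) = res_norm \<Delta> z"
  by (simp add: res_conj_def res_norm_def)

lemma res_norm_mult: "res_norm \<Delta> (res_mult \<Delta> z w) = res_norm \<Delta> z * res_norm \<Delta> w"
  by (simp add: res_norm_def res_mult_def algebra_simps power2_eq_square)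

lemma res_norm_cube: "res_norm \<Delta> (res_cube \<Delta> z) = res_norm \<Delta> z ^ 3"
  by (simp add: res_cube_def res_norm_mult power3_eq_cube)

lemma res_norm_scale: "res_norm \<Delta> (k *s z) = k ^ 2 * res_norm \<Delta> z"
  by (simp add: res_norm_def algebra_simps power2_eq_square)

lemma res_cube_mult: "res_cube \<Delta> (res_mult \<Delta> z w) = res_mult \<Delta> (res_cube \<Delta> z) (res_cube \<Delta> w)"
  by (simp add: res_cube_def ac_simps)

lemma res_cube_scale: "res_cube \<Delta> (k *s z) = k ^ 3 *s res_cube \<Delta> z"
  by (simp add: res_cube_def res_mult_scale vector_smult_assoc power3_eq_cube mult.assoc)

lemma res_cube_of_scalar: "res_cube \<Delta> (vector [k, 0]) = vector [k ^ 3, 0]"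
  by (simp add: res_cube_def res_mult_def vec_2_eq_iff power3_eq_cube)

definition res_mult_matrix :: "'a::comm_ring_1 \<Rightarrow> 'a ^ 2 \<Rightarrow> 'a ^ 2 ^ 2" where
  "res_mult_matrix \<Delta> w = vector [w, vector [- 3 * \<Delta> * w $ 2, w $ 1]]"

lemma vector_matrix_mult_res_mult_matrix: "v v* res_mult_matrix \<Delta> w = res_mult \<Delta> v w"
  by (simp add: res_mult_matrix_def res_mult_def vector_matrix_mult_2 vec_2_eq_iff algebra_simps)

lemma det_res_mult_matrix: "det (res_mult_matrix \<Delta> w) = res_norm \<Delta> w"
  by (simp add: res_mult_matrix_def res_norm_def det_2 algebra_simps power2_eq_square)

lemma same_res_cube_with_norm:
  fixes \<Delta> :: "'a::field"
  assumes "res_norm \<Delta> z ^ 3 = h ^ 3" "h \<noteq> 0"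
  obtains w where "res_norm \<Delta> w = h" "res_cube \<Delta> w = res_cube \<Delta> z"
proof -
  define \<rho> where "\<rho> = h / res_norm \<Delta> z"
  have z: "res_norm \<Delta> z \<noteq> 0"
    using assms by auto
  then have \<rho>: "\<rho> ^ 3 = 1"
    using assms by (simp add: \<rho>_def power_divide)
  \<comment> \<open>\<open>\<rho>\<^sup>2\<close> is a cube root of unity in \<open>K\<close>, and its norm is \<open>\<rho>\<^sup>4 = \<rho>\<close>.\<close>
  have "res_norm \<Delta> (\<rho> ^ 2 *s z) = \<rho> ^ 3 * (\<rho> * res_norm \<Delta> z)"
    by (simp add: res_norm_scale eval_nat_numeral)
  moreover have "res_cube \<Delta> (\<rho> ^ 2 *s z) = (\<rho> ^ 3) ^ 2 *s res_cube \<Delta> z"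
    by (simp add: res_cube_scale flip: power_mult)
  ultimately show ?thesis
    using z by (intro that[of "\<rho> ^ 2 *s z"]) (simp_all add: \<rho>, simp_all add: \<rho>_def)
qed

subsection \<open>The resolvent algebra and its units modulo cubes\<close>

definition resolvent_elt :: "'a::field \<Rightarrow> 'a ^ 2 \<Rightarrow> 'a poly set" where
  "resolvent_elt \<Delta> z = resolvent_class \<Delta> [:z $ 1, z $ 2:]"

lemma ideal_resolvent_ideal:
  "ideal (resolvent_ideal \<Delta>) (ring_of_type_algebra :: 'a::field poly ring)"
  by (rule cring.cgenideal_ideal[OF cring_from_type_algebra]) (simp add: ring_of_type_algebra_def)

lemma cring_resolvent_algebra: "cring (resolvent_algebra \<Delta>)"
  unfolding resolvent_algebra_def
  by (rule ideal.quotient_is_cring[OF ideal_resolvent_ideal cring_from_type_algebra])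

lemma resolvent_class_hom:
  "resolvent_class \<Delta> \<in> ring_hom ring_of_type_algebra (resolvent_algebra \<Delta>)"
  using ideal.rcos_ring_hom[OF ideal_resolvent_ideal, of \<Delta>]
  by (simp add: resolvent_class_def[abs_def] resolvent_algebra_def)

lemma
  shows resolvent_class_mult:
      "resolvent_class \<Delta> p \<otimes>\<^bsub>resolvent_algebra \<Delta>\<^esub> resolvent_class \<Delta> q = resolvent_class \<Delta> (p * q)"
    and resolvent_class_add:
      "resolvent_class \<Delta> p \<oplus>\<^bsub>resolvent_algebra \<Delta>\<^esub> resolvent_class \<Delta> q = resolvent_class \<Delta> (p + q)"
    and resolvent_class_one: "\<one>\<^bsub>resolvent_algebra \<Delta>\<^esub> = resolvent_class \<Delta> 1"
  using ring_hom_mult[OF resolvent_class_hom, of p q \<Delta>]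
    ring_hom_add[OF resolvent_class_hom, of p q \<Delta>] ring_hom_one[OF resolvent_class_hom, of \<Delta>]
  by (simp_all add: ring_of_type_algebra_def)

lemma carrier_resolvent_algebra: "carrier (resolvent_algebra \<Delta>) = range (resolvent_class \<Delta>)"
  by (auto simp: resolvent_algebra_def resolvent_class_def[abs_def] FactRing_def A_RCOSETS_def'
      ring_of_type_algebra_def)

lemma a_minus_ring_of_type_algebra:
  "p \<ominus>\<^bsub>ring_of_type_algebra\<^esub> q = p - (q :: 'a::comm_ring_1)"
proof -
  interpret R: cring "ring_of_type_algebra :: 'a ring" by (rule cring_from_type_algebra)
  have "\<ominus>\<^bsub>ring_of_type_algebra\<^esub> q = - q"
    by (rule R.minus_equality) (auto simp: ring_of_type_algebra_def)
  then show ?thesis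
    by (simp add: a_minus_def ring_of_type_algebra_def)
qed

lemma resolvent_class_eq_iff:
  "resolvent_class \<Delta> p = resolvent_class \<Delta> q \<longleftrightarrow> [:3 * \<Delta>, 0, 1:] dvd p - q"
proof -
  interpret R: cring "ring_of_type_algebra :: 'a poly ring" by (rule cring_from_type_algebra)
  have "resolvent_class \<Delta> p = resolvent_class \<Delta> q \<longleftrightarrow> p - q \<in> resolvent_ideal \<Delta>"
    using R.quotient_eq_iff_same_a_r_cos[OF ideal_resolvent_ideal, of p q]
    by (simp add: resolvent_class_def a_minus_ring_of_type_algebra)
      (simp add: ring_of_type_algebra_def)
  also have "\<dots> \<longleftrightarrow> [:3 * \<Delta>, 0, 1:] dvd p - q"
    by (auto simp: cgenideal_def ring_of_type_algebra_def dvd_def mult.commute)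
  finally show ?thesis .
qed

lemma resolvent_elt_eq_iff: "resolvent_elt \<Delta> z = resolvent_elt \<Delta> w \<longleftrightarrow> z = w"
proof
  assume "resolvent_elt \<Delta> z = resolvent_elt \<Delta> w"
  then have "[:3 * \<Delta>, 0, 1:] dvd [:z $ 1 - w $ 1, z $ 2 - w $ 2:]"
    by (simp add: resolvent_elt_def resolvent_class_eq_iff)
  moreover have "Polynomial.degree [:z $ 1 - w $ 1, z $ 2 - w $ 2:]
      < Polynomial.degree [:3 * \<Delta>, 0, 1:]"
    by simp
  ultimately have "[:z $ 1 - w $ 1, z $ 2 - w $ 2:] = 0"
    using dvd_imp_degree_le leD by blast
  then show "z = w"
    by (simp add: vec_2_eq_iff)
qed simp

lemma resolvent_class_eq_elt: "\<exists>z. resolvent_class \<Delta> p = resolvent_elt \<Delta> z"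
proof
  define r where "r = p mod [:3 * \<Delta>, 0, 1:]"
  have "Polynomial.degree r < 2"
    using degree_mod_less'[of "[:3 * \<Delta>, 0, 1:]" p] by (cases "r = 0") (auto simp: r_def)
  then have "r = [:poly.coeff r 0, poly.coeff r 1:]"
    by (intro poly_eqI) (auto simp: coeff_pCons coeff_eq_0 split: nat.splits)
  moreover have "resolvent_class \<Delta> p = resolvent_class \<Delta> r"
    by (simp add: resolvent_class_eq_iff r_def dvd_minus_mod)
  ultimately show "resolvent_class \<Delta> p = resolvent_elt \<Delta> (vector [poly.coeff r 0, poly.coeff r 1])"
    by (simp add: resolvent_elt_def)
qed

lemma carrier_resolvent_algebra_elt:
  "carrier (resolvent_algebra \<Delta>) = range (resolvent_elt \<Delta>)"
proof -
  have "resolvent_class \<Delta> p \<in> range (resolvent_elt \<Delta>)" for p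
    using resolvent_class_eq_elt[of \<Delta> p] by blast
  then show ?thesis
    by (auto simp: carrier_resolvent_algebra resolvent_elt_def)
qed

lemma resolvent_elt_mult:
  "resolvent_elt \<Delta> z \<otimes>\<^bsub>resolvent_algebra \<Delta>\<^esub> resolvent_elt \<Delta> w = resolvent_elt \<Delta> (res_mult \<Delta> z w)"
  unfolding resolvent_elt_def resolvent_class_mult resolvent_class_eq_iff
  by (rule dvdI[of _ _ "[:z $ 2 * w $ 2:]"]) (simp add: res_mult_def algebra_simps)

lemma resolvent_elt_one: "\<one>\<^bsub>resolvent_algebra \<Delta>\<^esub> = resolvent_elt \<Delta> (vector [1, 0])"
  by (simp add: resolvent_class_one resolvent_elt_def one_pCons)

lemma ex_res_inverse_iff: "(\<exists>w. res_mult \<Delta> z w = vector [1, 0]) \<longleftrightarrow> res_norm \<Delta> z \<noteq> 0"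
  for \<Delta> :: "'a::field"
proof
  assume "\<exists>w. res_mult \<Delta> z w = vector [1, 0]"
  then obtain w where "res_mult \<Delta> z w = vector [1, 0]" ..
  then have "res_norm \<Delta> z * res_norm \<Delta> w = 1"
    by (simp add: res_norm_of_scalar flip: res_norm_mult)
  then show "res_norm \<Delta> z \<noteq> 0" by auto
next
  assume "res_norm \<Delta> z \<noteq> 0"
  then have "res_mult \<Delta> z (inverse (res_norm \<Delta> z) *s res_conj z) = vector [1, 0]"
    by (simp add: res_mult_scale res_mult_conj vec_2_eq_iff)
  then show "\<exists>w. res_mult \<Delta> z w = vector [1, 0]" ..
qed

lemma resolvent_elt_unit_iff:
  "resolvent_elt \<Delta> z \<in> carrier (resolvent_units \<Delta>) \<longleftrightarrow> res_norm \<Delta> z \<noteq> 0"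
  by (simp add: resolvent_units_def units_of_carrier Units_def carrier_resolvent_algebra_elt
      resolvent_elt_mult resolvent_elt_one resolvent_elt_eq_iff res_mult.commute[of \<Delta> _ z]
      flip: ex_res_inverse_iff)

lemma carrier_resolvent_units:
  "carrier (resolvent_units \<Delta>) = resolvent_elt \<Delta> ` {z. res_norm \<Delta> z \<noteq> 0}"
proof -
  have "carrier (resolvent_units \<Delta>) \<subseteq> range (resolvent_elt \<Delta>)"
    by (auto simp: resolvent_units_def units_of_carrier Units_def
        simp flip: carrier_resolvent_algebra_elt)
  then show ?thesis
    using resolvent_elt_unit_iff by fast
qed

lemma resolvent_units_mult:
  "resolvent_elt \<Delta> z \<otimes>\<^bsub>resolvent_units \<Delta>\<^esub> resolvent_elt \<Delta> w = resolvent_elt \<Delta> (res_mult \<Delta> z w)"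
  by (simp add: resolvent_units_def units_of_mult resolvent_elt_mult)

lemma comm_group_resolvent_units: "comm_group (resolvent_units \<Delta>)"
  unfolding resolvent_units_def
  using cring_resolvent_algebra by (rule comm_monoid.units_comm_group[OF cring.axioms(2)])

lemma resolvent_elt_cube:
  "resolvent_elt \<Delta> z [^]\<^bsub>resolvent_units \<Delta>\<^esub> (3::nat) = resolvent_elt \<Delta> (res_cube \<Delta> z)"
  by (simp add: numeral_3_eq_3 nat_pow_def resolvent_units_def units_of_one units_of_mult
      resolvent_elt_one resolvent_elt_mult res_mult_of_scalar res_cube_def ac_simps)

lemma resolvent_cubes_eq: "resolvent_cubes \<Delta> = resolvent_elt \<Delta> ` res_cube \<Delta> ` {w. res_norm \<Delta> w \<noteq> 0}"
  unfolding resolvent_cubes_def carrier_resolvent_units image_image resolvent_elt_cube ..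

lemma subgroup_resolvent_cubes: "subgroup (resolvent_cubes \<Delta>) (resolvent_units \<Delta>)"
proof -
  interpret U: comm_group "resolvent_units \<Delta>" by (rule comm_group_resolvent_units)
  have "(\<lambda>w. w [^]\<^bsub>resolvent_units \<Delta>\<^esub> (3::nat)) \<in> hom (resolvent_units \<Delta>) (resolvent_units \<Delta>)"
    by (auto simp: hom_def U.nat_pow_distrib)
  then show ?thesis
    unfolding resolvent_cubes_def
    by (intro group_hom.img_is_subgroup group_hom.intro U.is_group group_hom_axioms.intro)
qed

lemma normal_resolvent_cubes: "resolvent_cubes \<Delta> \<lhd> resolvent_units \<Delta>"
  by (rule comm_group.subgroup_imp_normal[OF comm_group_resolvent_units subgroup_resolvent_cubes])

lemma comm_group_units_mod_cubes: "comm_group (units_mod_cubes \<Delta>)"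
  unfolding units_mod_cubes_def
  by (rule comm_group.abelian_FactGroup[OF comm_group_resolvent_units subgroup_resolvent_cubes])

abbreviation cube_class :: "'a::field \<Rightarrow> 'a ^ 2 \<Rightarrow> 'a poly set set" where
  "cube_class \<Delta> z \<equiv> resolvent_cubes \<Delta> #>\<^bsub>resolvent_units \<Delta>\<^esub> resolvent_elt \<Delta> z"

lemma carrier_units_mod_cubes:
  "carrier (units_mod_cubes \<Delta>) = cube_class \<Delta> ` {z. res_norm \<Delta> z \<noteq> 0}"
  by (auto simp: units_mod_cubes_def carrier_FactGroup carrier_resolvent_units)

lemma cube_class_eq_iff:
  assumes "res_norm \<Delta> z \<noteq> 0" "res_norm \<Delta> z' \<noteq> 0"
  shows "cube_class \<Delta> z = cube_class \<Delta> z' \<longleftrightarrow> (\<exists>w. z = res_mult \<Delta> (res_cube \<Delta> w) z')"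
proof -
  interpret U: comm_group "resolvent_units \<Delta>" by (rule comm_group_resolvent_units)
  have units: "resolvent_elt \<Delta> z \<in> carrier (resolvent_units \<Delta>)"
      "resolvent_elt \<Delta> z' \<in> carrier (resolvent_units \<Delta>)"
    using assms by (simp_all add: resolvent_elt_unit_iff)
  have "cube_class \<Delta> z = cube_class \<Delta> z' \<longleftrightarrow> resolvent_elt \<Delta> z \<in> cube_class \<Delta> z'"
    using U.repr_independence[OF _ units(2) subgroup_resolvent_cubes]
      U.repr_independenceD[OF subgroup_resolvent_cubes units(1)] by metis
  also have "\<dots> \<longleftrightarrow> (\<exists>w. res_norm \<Delta> w \<noteq> 0 \<and> z = res_mult \<Delta> (res_cube \<Delta> w) z')"
    by (simp add: r_coset_def resolvent_cubes_eq resolvent_units_mult resolvent_elt_eq_iff)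
  also have "\<dots> \<longleftrightarrow> (\<exists>w. z = res_mult \<Delta> (res_cube \<Delta> w) z')"
    using assms(1) by (auto simp: res_norm_mult res_norm_cube)
  finally show ?thesis .
qed

lemma cube_class_mult:
  assumes "res_norm \<Delta> z \<noteq> 0" "res_norm \<Delta> z' \<noteq> 0"
  shows "cube_class \<Delta> z \<otimes>\<^bsub>units_mod_cubes \<Delta>\<^esub> cube_class \<Delta> z' = cube_class \<Delta> (res_mult \<Delta> z z')"
  using assms normal.rcos_sum[OF normal_resolvent_cubes,
      of "resolvent_elt \<Delta> z" \<Delta> "resolvent_elt \<Delta> z'"]
  by (simp add: units_mod_cubes_def resolvent_elt_unit_iff resolvent_units_mult)

lemma cube_class_cube:
  assumes "res_norm \<Delta> z \<noteq> 0"
  shows "cube_class \<Delta> (res_cube \<Delta> z) = \<one>\<^bsub>units_mod_cubes \<Delta>\<^esub>"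
proof -
  interpret U: comm_group "resolvent_units \<Delta>" by (rule comm_group_resolvent_units)
  show ?thesis
    using U.coset_join2[OF _ subgroup_resolvent_cubes, of "resolvent_elt \<Delta> (res_cube \<Delta> z)"] assms
    by (simp add: units_mod_cubes_def resolvent_elt_unit_iff res_norm_cube resolvent_cubes_eq)
qed

lemma units_mod_cubes_pow_3:
  assumes "q \<in> carrier (units_mod_cubes \<Delta>)"
  shows "q [^]\<^bsub>units_mod_cubes \<Delta>\<^esub> (3::nat) = \<one>\<^bsub>units_mod_cubes \<Delta>\<^esub>"
proof -
  obtain z where z: "res_norm \<Delta> z \<noteq> 0" "q = cube_class \<Delta> z"
    using assms by (auto simp: carrier_units_mod_cubes)
  have "q [^]\<^bsub>units_mod_cubes \<Delta>\<^esub> (3::nat) = cube_class \<Delta> (res_cube \<Delta> z)"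
    using normal.FactGroup_pow[OF normal_resolvent_cubes, of "resolvent_elt \<Delta> z" \<Delta> 3] z
    by (simp add: units_mod_cubes_def resolvent_elt_unit_iff resolvent_elt_cube)
  then show ?thesis
    using z by (simp add: cube_class_cube)
qed

lemma inv_cube_class:
  assumes norm: "res_norm \<Delta> z = h ^ 3" and "h \<noteq> 0"
  shows "inv\<^bsub>units_mod_cubes \<Delta>\<^esub> cube_class \<Delta> z = cube_class \<Delta> (res_conj z)"
proof -
  interpret Q: comm_group "units_mod_cubes \<Delta>" by (rule comm_group_units_mod_cubes)
  have "cube_class \<Delta> (res_mult \<Delta> (res_conj z) z) = cube_class \<Delta> (res_cube \<Delta> (vector [h, 0]))"
    by (simp add: res_mult.commute[of \<Delta> _ z] res_mult_conj norm res_cube_of_scalar)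
  also have "\<dots> = \<one>\<^bsub>units_mod_cubes \<Delta>\<^esub>"
    using assms by (intro cube_class_cube) (simp add: res_norm_of_scalar)
  finally show ?thesis
    using assms by (intro Q.inv_equality) (auto simp: cube_class_mult carrier_units_mod_cubes)
qed

subsection \<open>The Hessian and the Cardano covariant\<close>

fun polar_hessian :: "'a::field bcf \<Rightarrow> 'a ^ 2 \<Rightarrow> 'a ^ 2 \<Rightarrow> 'a" where
  "polar_hessian (BCF a b c d) v w =
     (b ^ 2 - 3 * a * c) * v $ 1 * w $ 1
     + (b * c - 9 * a * d) / 2 * (v $ 1 * w $ 2 + v $ 2 * w $ 1)
     + (c ^ 2 - 3 * b * d) * v $ 2 * w $ 2"

lemma polar_hessian_commute: "polar_hessian g v w = polar_hessian g w v"
  by (cases g) (simp add: algebra_simps)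

lemma polar_hessian_expand:
  "polar_hessian g v w =
    v $ 1 * polar_hessian g (axis 1 1) w + v $ 2 * polar_hessian g (axis 2 1) w"
  by (cases g) (simp add: axis_def algebra_simps)

lemma det_polar_hessian:
  fixes g :: "'a::field bcf"
  assumes "(2::'a) \<noteq> 0"
  shows "4 * (polar_hessian g (axis 1 1) (axis 1 1) * polar_hessian g (axis 2 1) (axis 2 1)
      - polar_hessian g (axis 1 1) (axis 2 1) ^ 2) = 3 * bcf_disc g"
proof -
  obtain a b c d where g: "g = BCF a b c d" by (cases g)
  have diag: "polar_hessian g (axis 1 1) (axis 1 1) = b ^ 2 - 3 * a * c"
      "polar_hessian g (axis 2 1) (axis 2 1) = c ^ 2 - 3 * b * d"
    by (simp_all add: g axis_def)
  have cross: "2 * polar_hessian g (axis 1 1) (axis 2 1) = b * c - 9 * a * d"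
    using assms by (simp add: g axis_def)
  have "4 * (polar_hessian g (axis 1 1) (axis 1 1) * polar_hessian g (axis 2 1) (axis 2 1)
        - polar_hessian g (axis 1 1) (axis 2 1) ^ 2) =
      4 * (polar_hessian g (axis 1 1) (axis 1 1) * polar_hessian g (axis 2 1) (axis 2 1))
        - (2 * polar_hessian g (axis 1 1) (axis 2 1)) ^ 2"
    by (simp add: algebra_simps power2_eq_square)
  also have "\<dots> = 4 * ((b ^ 2 - 3 * a * c) * (c ^ 2 - 3 * b * d)) - (b * c - 9 * a * d) ^ 2"
    by (simp only: diag cross)
  also have "\<dots> = 3 * bcf_disc g"
    by (simp add: g, Groebner_Basis.algebra)
  finally show ?thesis .
qed

lemma polar_hessian_nonzero:
  fixes g :: "'a::field bcf"
  assumes two: "(2::'a) \<noteq> 0" and three: "(3::'a) \<noteq> 0" and disc: "bcf_disc g \<noteq> 0"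
  obtains v where "polar_hessian g v v \<noteq> 0"
proof (rule ccontr)
  assume "\<not> thesis"
  then have zero: "polar_hessian g v v = 0" for v
    using that by blast
  let ?u = "vector [1, 1] :: 'a ^ 2"
  have expand: "polar_hessian g ?u w = polar_hessian g (axis 1 1) w + polar_hessian g (axis 2 1) w"
    for w
    using polar_hessian_expand[of g ?u w] by simp
  have "polar_hessian g ?u ?u = 2 * polar_hessian g (axis 1 1) (axis 2 1)"
    using zero[of "axis 1 1"] zero[of "axis 2 1"]
    by (simp add: expand polar_hessian_commute[of g "axis _ 1" ?u]
        polar_hessian_commute[of g "axis 2 1" "axis 1 1"])
  then have "polar_hessian g (axis 1 1) (axis 2 1) = 0"
    using zero[of ?u] two by simp
  then show False
    using det_polar_hessian[OF two, of g] zero three disc by simp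
qed

definition cardano_coords :: "'a::field bcf \<Rightarrow> 'a ^ 2 \<Rightarrow> 'a ^ 2" where
  "cardano_coords g v = vector [bcf_at (cubic_covariant g) v / 2, 3 * bcf_at g v / 2]"

definition cardano_polar :: "'a::field bcf \<Rightarrow> 'a ^ 2 \<Rightarrow> 'a ^ 2 \<Rightarrow> 'a ^ 2" where
  "cardano_polar g v w = vector [polar_hessian g v w, (v $ 2 * w $ 1 - v $ 1 * w $ 2) / 2]"

lemma cardano_syzygy:
  fixes g :: "'a::field bcf"
  assumes two: "(2::'a) \<noteq> 0"
  shows "res_mult (bcf_disc g) (cardano_coords g v) (res_conj (cardano_coords g w))
    = res_cube (bcf_disc g) (cardano_polar g v w)"
proof -
  obtain a b c d where g: "g = BCF a b c d" by (cases g)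
  define h :: 'a where "h = 1 / 2"
  have half: "k / 2 = h * k" for k by (simp add: h_def)
  have "2 * h = 1" using two by (simp add: h_def)
  then show ?thesis
    unfolding g vec_2_eq_iff
    by (simp add: cardano_coords_def cardano_polar_def res_mult_def res_cube_def res_conj_def half;
        intro conjI; Groebner_Basis.algebra)
qed

definition cardano_frame :: "'a::field bcf \<Rightarrow> 'a ^ 2 \<Rightarrow> 'a ^ 2 ^ 2" where
  "cardano_frame g w = (\<chi> i. inverse (polar_hessian g w w) *s cardano_polar g (axis i 1) w)"

lemma vector_matrix_mult_cardano_frame:
  "v v* cardano_frame g w = inverse (polar_hessian g w w) *s cardano_polar g v w"
  by (simp add: cardano_frame_def cardano_polar_def polar_hessian_expand[of g v w] vec_2_eq_iff
      vector_matrix_mult_2 axis_def algebra_simps diff_divide_distrib)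

lemma cardano_polar_self: "cardano_polar g v v = vector [polar_hessian g v v, 0]"
  by (simp add: cardano_polar_def)

lemma res_norm_cardano_coords:
  fixes g :: "'a::field bcf"
  assumes "(2::'a) \<noteq> 0"
  shows "res_norm (bcf_disc g) (cardano_coords g v) = polar_hessian g v v ^ 3"
  using cardano_syzygy[OF assms, of g v v]
  by (simp add: res_mult_conj cardano_polar_self res_cube_of_scalar vec_2_eq_iff)

lemma det_cardano_frame:
  fixes g :: "'a::field bcf"
  assumes "polar_hessian g w w \<noteq> 0"
  shows "det (cardano_frame g w) = 1 / (2 * polar_hessian g w w)"
proof -
  have "det (cardano_frame g w) = inverse (polar_hessian g w w) ^ 2
      * ((w $ 1 * polar_hessian g (axis 1 1) w + w $ 2 * polar_hessian g (axis 2 1) w) / 2)"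
    by (simp add: cardano_frame_def cardano_polar_def det_2 power2_eq_square
        axis_def algebra_simps add_divide_distrib)
  also have "\<dots> = 1 / (2 * polar_hessian g w w)"
    using assms by (simp add: power2_eq_square field_simps flip: polar_hessian_expand)
  finally show ?thesis .
qed

lemma cardano_coords_eq:
  fixes g :: "'a::field bcf"
  assumes two: "(2::'a) \<noteq> 0" and disc: "bcf_disc g = \<Delta>" and w: "polar_hessian g w w \<noteq> 0"
  shows "cardano_coords g v =
    res_mult \<Delta> (res_cube \<Delta> (v v* cardano_frame g w)) (cardano_coords g w)"
proof -
  let ?C = "cardano_coords g"
  define h where "h = polar_hessian g w w"
  have "h ^ 3 *s ?C v = res_mult \<Delta> (res_mult \<Delta> (?C w) (res_conj (?C w))) (?C v)"
    using res_norm_cardano_coords[OF two, of g w]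
    by (simp add: h_def disc res_mult_conj res_mult_of_scalar)
  also have "\<dots> = res_mult \<Delta> (res_mult \<Delta> (?C v) (res_conj (?C w))) (?C w)"
    by (simp add: ac_simps)
  also have "\<dots> = res_mult \<Delta> (res_cube \<Delta> (cardano_polar g v w)) (?C w)"
    using cardano_syzygy[OF two, of g v w] disc by simp
  finally have "inverse h ^ 3 *s (h ^ 3 *s ?C v) =
      inverse h ^ 3 *s res_mult \<Delta> (res_cube \<Delta> (cardano_polar g v w)) (?C w)"
    by simp
  then show ?thesis
    using w by (simp add: h_def vector_matrix_mult_cardano_frame res_cube_scale res_mult_scale
        vector_smult_assoc flip: power_mult_distrib)
qed

lemma cardano_coords_twist:
  assumes "det M \<noteq> 0"
  shows "cardano_coords (bcf_twist g M) v =
    vector [cardano_coords g (v v* M) $ 1, inverse (det M) * cardano_coords g (v v* M) $ 2]"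
  using assms by (simp add: cardano_coords_def bcf_at_cubic_covariant_twist bcf_at_twist
      mult.left_commute[of 3])

lemma cardano_coords_inj:
  fixes g h :: "'a::field bcf"
  assumes two: "(2::'a) \<noteq> 0" and three: "(3::'a) \<noteq> 0"
    and eq: "\<And>v. cardano_coords g v = cardano_coords h v"
  shows "g = h"
proof (rule bcf_eqI[OF two])
  fix v
  have "3 * bcf_at g v / 2 = 3 * bcf_at h v / 2"
    using arg_cong[OF eq[of v], of "\<lambda>z :: 'a ^ 2. z $ 2"]
    by (simp only: cardano_coords_def vector_2)
  then show "bcf_at g v = bcf_at h v"
    using two three by (metis divide_cancel_right mult_cancel_left)
qed

lemma cardano_cube_multiple_imp_coords_eq:
  fixes g1 g2 :: "'a::field bcf"
  assumes two: "(2::'a) \<noteq> 0"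
    and disc: "bcf_disc g1 = \<Delta>" "bcf_disc g2 = \<Delta>"
    and nonzero: "polar_hessian g1 v1 v1 \<noteq> 0" "polar_hessian g2 v2 v2 \<noteq> 0"
    and cube: "cardano_coords g1 v1 = res_mult \<Delta> (res_cube \<Delta> w) (cardano_coords g2 v2)"
    and norm: "res_norm \<Delta> w = polar_hessian g1 v1 v1 / polar_hessian g2 v2 v2"
  obtains M where "det M = 1" "\<And>v. cardano_coords g1 v = cardano_coords g2 (v v* M)"
proof -
  define A1 A2 where A: "A1 = cardano_frame g1 v1" "A2 = cardano_frame g2 v2"
  have det: "det A1 = 1 / (2 * polar_hessian g1 v1 v1)" "det A2 = 1 / (2 * polar_hessian g2 v2 v2)"
    using det_cardano_frame nonzero by (simp_all add: A)
  then have "invertible A2"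
    using nonzero two by (simp add: invertible_det_nz)
  then obtain B where B: "B ** A2 = mat 1"
    by (auto simp: invertible_def)
  then have "det B * det A2 = 1"
    by (metis det_mul det_I)
  then have det_B: "det B = 2 * polar_hessian g2 v2 v2"
    using nonzero two by (simp add: det field_simps)
  define M where "M = A1 ** res_mult_matrix \<Delta> w ** B"
  have det_M: "det M = 1"
    using nonzero two by (simp add: M_def det_mul det det_B det_res_mult_matrix norm)
  have "M ** A2 = A1 ** res_mult_matrix \<Delta> w"
    by (simp add: M_def B flip: matrix_mul_assoc)
  then have frames: "v v* M v* A2 = res_mult \<Delta> (v v* A1) w" for v
    by (simp add: vector_matrix_mul_assoc flip: vector_matrix_mult_res_mult_matrix)
  have "cardano_coords g1 v = cardano_coords g2 (v v* M)" for v
  proof -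
    have "cardano_coords g1 v = res_mult \<Delta> (res_cube \<Delta> (v v* A1)) (cardano_coords g1 v1)"
      unfolding A by (rule cardano_coords_eq[OF two disc(1) nonzero(1)])
    also have "\<dots> = res_mult \<Delta> (res_cube \<Delta> (v v* M v* A2)) (cardano_coords g2 v2)"
      by (simp add: cube frames res_cube_mult res_mult.assoc)
    also have "\<dots> = cardano_coords g2 (v v* M)"
      unfolding A by (rule cardano_coords_eq[OF two disc(2) nonzero(2), symmetric])
    finally show ?thesis .
  qed
  with det_M show ?thesis
    by (rule that)
qed

lemma cardano_cube_multiple_imp_twist:
  fixes g1 g2 :: "'a::field bcf"
  assumes two: "(2::'a) \<noteq> 0" and three: "(3::'a) \<noteq> 0"
    and disc: "bcf_disc g1 = \<Delta>" "bcf_disc g2 = \<Delta>"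
    and units: "res_norm \<Delta> (cardano_coords g1 v1) \<noteq> 0" "res_norm \<Delta> (cardano_coords g2 v2) \<noteq> 0"
    and cube: "cardano_coords g1 v1 = res_mult \<Delta> (res_cube \<Delta> z) (cardano_coords g2 v2)"
  obtains M where "det M = 1" "g1 = bcf_twist g2 M"
proof -
  define h1 h2 where h: "h1 = polar_hessian g1 v1 v1" "h2 = polar_hessian g2 v2 v2"
  have norms: "res_norm \<Delta> (cardano_coords g1 v1) = h1 ^ 3"
      "res_norm \<Delta> (cardano_coords g2 v2) = h2 ^ 3"
    using res_norm_cardano_coords[OF two] disc by (metis h)+
  then have nonzero: "h1 \<noteq> 0" "h2 \<noteq> 0"
    using units by auto
  have "h1 ^ 3 = res_norm \<Delta> z ^ 3 * h2 ^ 3"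
    using arg_cong[OF cube, of "res_norm \<Delta>"] by (simp add: norms res_norm_mult res_norm_cube)
  then have "res_norm \<Delta> z ^ 3 = (h1 / h2) ^ 3"
    using nonzero by (simp add: power_divide)
  then obtain w where w: "res_norm \<Delta> w = h1 / h2" "res_cube \<Delta> w = res_cube \<Delta> z"
    using same_res_cube_with_norm nonzero by (metis divide_eq_0_iff)
  have "cardano_coords g1 v1 = res_mult \<Delta> (res_cube \<Delta> w) (cardano_coords g2 v2)"
    by (simp add: cube w)
  then obtain M where M: "det M = 1" "\<And>v. cardano_coords g1 v = cardano_coords g2 (v v* M)"
    using cardano_cube_multiple_imp_coords_eq[OF two disc nonzero[unfolded h] _ w(1)[unfolded h]]
    by blast
  then have "g1 = bcf_twist g2 M"
    by (intro cardano_coords_inj[OF two three]) (simp add: cardano_coords_twist vec_2_eq_iff)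
  then show ?thesis
    using M(1) that by blast
qed

subsection \<open>The Cardano invariant\<close>

lemma cardano_covariant_eq:
  "cardano_covariant \<Delta> g (v $ 1) (v $ 2) = resolvent_elt \<Delta> (cardano_coords g v)"
  by (simp add: cardano_covariant_def Let_def resolvent_const_def resolvent_delta_def
      resolvent_class_mult resolvent_class_add resolvent_elt_def cardano_coords_def algebra_simps)

lemma res_norm_cardano_coords_eq_0_iff:
  fixes g :: "'a::field bcf"
  assumes "(2::'a) \<noteq> 0" "bcf_disc g = \<Delta>"
  shows "res_norm \<Delta> (cardano_coords g v) = 0 \<longleftrightarrow> polar_hessian g v v = 0"
  using res_norm_cardano_coords[OF assms(1), of g v] assms(2) by simp

lemma cube_class_cardano_coords_unique:
  fixes g :: "'a::field bcf"
  assumes two: "(2::'a) \<noteq> 0" and disc: "bcf_disc g = \<Delta>"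
    and units: "res_norm \<Delta> (cardano_coords g v) \<noteq> 0" "res_norm \<Delta> (cardano_coords g w) \<noteq> 0"
  shows "cube_class \<Delta> (cardano_coords g v) = cube_class \<Delta> (cardano_coords g w)"
proof -
  have "polar_hessian g w w \<noteq> 0"
    using units(2) res_norm_cardano_coords_eq_0_iff[OF two disc] by simp
  then have "cardano_coords g v =
      res_mult \<Delta> (res_cube \<Delta> (v v* cardano_frame g w)) (cardano_coords g w)"
    by (rule cardano_coords_eq[OF two disc])
  then show ?thesis
    using cube_class_eq_iff[OF units] by blast
qed

lemma cardano_invariant_eq:
  fixes g :: "'a::field bcf"
  assumes two: "(2::'a) \<noteq> 0" and disc: "bcf_disc g = \<Delta>"
    and unit: "res_norm \<Delta> (cardano_coords g v) \<noteq> 0"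
  shows "cardano_invariant \<Delta> g = cube_class \<Delta> (cardano_coords g v)"
proof -
  have "(\<exists>x y. P x y) \<longleftrightarrow> (\<exists>w :: 'a ^ 2. P (w $ 1) (w $ 2))" for P
    by (metis vector_2)
  then have "cardano_invariant \<Delta> g = (THE \<zeta>. \<exists>w. res_norm \<Delta> (cardano_coords g w) \<noteq> 0 \<and>
      \<zeta> = cube_class \<Delta> (cardano_coords g w))"
    by (simp add: cardano_invariant_def cardano_covariant_eq resolvent_elt_unit_iff)
  also have "\<dots> = cube_class \<Delta> (cardano_coords g v)"
    using unit cube_class_cardano_coords_unique[OF two disc] by (intro the_equality) blast+
  finally show ?thesis .
qed

lemma cardano_coords_unit:
  fixes g :: "'a::field bcf"
  assumes "(2::'a) \<noteq> 0" "(3::'a) \<noteq> 0" "\<Delta> \<noteq> 0" "bcf_disc g = \<Delta>"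
  obtains v where "res_norm \<Delta> (cardano_coords g v) \<noteq> 0"
  using polar_hessian_nonzero assms by (metis res_norm_cardano_coords_eq_0_iff)

lemma cardano_invariant_closed:
  fixes g :: "'a::field bcf"
  assumes "(2::'a) \<noteq> 0" "(3::'a) \<noteq> 0" "\<Delta> \<noteq> 0" "bcf_disc g = \<Delta>"
  shows "cardano_invariant \<Delta> g \<in> carrier (units_mod_cubes \<Delta>)"
proof -
  obtain v where "res_norm \<Delta> (cardano_coords g v) \<noteq> 0"
    using cardano_coords_unit[OF assms] .
  then show ?thesis
    using assms by (auto simp: cardano_invariant_eq carrier_units_mod_cubes)
qed

lemma cardano_invariant_twist_det_1:
  fixes g :: "'a::field bcf"
  assumes two: "(2::'a) \<noteq> 0" and three: "(3::'a) \<noteq> 0" and "\<Delta> \<noteq> 0"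
    and disc: "bcf_disc g = \<Delta>" and det: "det M = 1"
  shows "cardano_invariant \<Delta> (bcf_twist g M) = cardano_invariant \<Delta> g"
proof -
  have disc': "bcf_disc (bcf_twist g M) = \<Delta>"
    using disc det by (simp add: bcf_disc_twist)
  obtain v where unit: "res_norm \<Delta> (cardano_coords (bcf_twist g M) v) \<noteq> 0"
    using cardano_coords_unit[OF two three \<open>\<Delta> \<noteq> 0\<close> disc'] .
  have "cardano_coords (bcf_twist g M) v = cardano_coords g (v v* M)"
    using det by (simp add: cardano_coords_twist vec_2_eq_iff)
  with unit show ?thesis
    by (simp add: cardano_invariant_eq[OF two disc' unit] cardano_invariant_eq[OF two disc])
qed

lemma cardano_invariant_twist_det_minus_1:
  fixes g :: "'a::field bcf"
  assumes two: "(2::'a) \<noteq> 0" and three: "(3::'a) \<noteq> 0" and "\<Delta> \<noteq> 0"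
    and disc: "bcf_disc g = \<Delta>" and det: "det M = -1"
  shows "cardano_invariant \<Delta> (bcf_twist g M) = inv\<^bsub>units_mod_cubes \<Delta>\<^esub> cardano_invariant \<Delta> g"
proof -
  have disc': "bcf_disc (bcf_twist g M) = \<Delta>"
    using disc det by (simp add: bcf_disc_twist)
  obtain v where unit': "res_norm \<Delta> (cardano_coords (bcf_twist g M) v) \<noteq> 0"
    using cardano_coords_unit[OF two three \<open>\<Delta> \<noteq> 0\<close> disc'] .
  have conj: "cardano_coords (bcf_twist g M) v = res_conj (cardano_coords g (v v* M))"
    using det by (simp add: cardano_coords_twist res_conj_def)
  with unit' have unit: "res_norm \<Delta> (cardano_coords g (v v* M)) \<noteq> 0"
    by simp
  have "cardano_invariant \<Delta> (bcf_twist g M) = cube_class \<Delta> (res_conj (cardano_coords g (v v* M)))"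
    using cardano_invariant_eq[OF two disc' unit'] conj by simp
  also have "\<dots> = inv\<^bsub>units_mod_cubes \<Delta>\<^esub> cube_class \<Delta> (cardano_coords g (v v* M))"
    using inv_cube_class[OF res_norm_cardano_coords[OF two, of g "v v* M", unfolded disc]] unit
    by (simp add: res_norm_cardano_coords_eq_0_iff[OF two disc])
  finally show ?thesis
    by (simp add: cardano_invariant_eq[OF two disc unit])
qed

lemma cardano_invariant_eq_iff_twist:
  fixes g1 g2 :: "'a::field bcf"
  assumes two: "(2::'a) \<noteq> 0" and three: "(3::'a) \<noteq> 0" and "\<Delta> \<noteq> 0"
    and disc: "bcf_disc g1 = \<Delta>" "bcf_disc g2 = \<Delta>"
  shows "cardano_invariant \<Delta> g1 = cardano_invariant \<Delta> g2 \<longleftrightarrow>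
    (\<exists>M. det M = 1 \<and> g2 = bcf_twist g1 M)"
proof
  assume eq: "cardano_invariant \<Delta> g1 = cardano_invariant \<Delta> g2"
  obtain v1 where v1: "res_norm \<Delta> (cardano_coords g1 v1) \<noteq> 0"
    using cardano_coords_unit[OF two three \<open>\<Delta> \<noteq> 0\<close> disc(1)] .
  obtain v2 where v2: "res_norm \<Delta> (cardano_coords g2 v2) \<noteq> 0"
    using cardano_coords_unit[OF two three \<open>\<Delta> \<noteq> 0\<close> disc(2)] .
  have "cube_class \<Delta> (cardano_coords g2 v2) = cube_class \<Delta> (cardano_coords g1 v1)"
    using eq cardano_invariant_eq[OF two disc(1) v1] cardano_invariant_eq[OF two disc(2) v2] by simp
  then obtain z where "cardano_coords g2 v2 = res_mult \<Delta> (res_cube \<Delta> z) (cardano_coords g1 v1)"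
    by (auto simp: cube_class_eq_iff[OF v2 v1])
  then show "\<exists>M. det M = 1 \<and> g2 = bcf_twist g1 M"
    using cardano_cube_multiple_imp_twist[OF two three disc(2,1) v2 v1] by metis
next
  assume "\<exists>M. det M = 1 \<and> g2 = bcf_twist g1 M"
  then show "cardano_invariant \<Delta> g1 = cardano_invariant \<Delta> g2"
    using cardano_invariant_twist_det_1[OF two three \<open>\<Delta> \<noteq> 0\<close> disc(1)] by auto
qed

lemma cardano_invariant_eq_inv_iff_twist:
  fixes g1 g2 :: "'a::field bcf"
  assumes two: "(2::'a) \<noteq> 0" and three: "(3::'a) \<noteq> 0" and "\<Delta> \<noteq> 0"
    and disc: "bcf_disc g1 = \<Delta>" "bcf_disc g2 = \<Delta>"
  shows "cardano_invariant \<Delta> g1 = inv\<^bsub>units_mod_cubes \<Delta>\<^esub> cardano_invariant \<Delta> g2 \<longleftrightarrow>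
    (\<exists>M. det M = -1 \<and> g2 = bcf_twist g1 M)"
    (is "?z g1 = inv\<^bsub>?Q\<^esub> ?z g2 \<longleftrightarrow> _")
proof
  interpret Q: comm_group ?Q by (rule comm_group_units_mod_cubes)
  note twist = cardano_invariant_twist_det_minus_1[OF two three \<open>\<Delta> \<noteq> 0\<close> disc(1)]
    and closed = cardano_invariant_closed[OF two three \<open>\<Delta> \<noteq> 0\<close>]
  show "\<exists>M. det M = -1 \<and> g2 = bcf_twist g1 M" if "?z g1 = inv\<^bsub>?Q\<^esub> ?z g2"
  proof -
    define J :: "'a ^ 2 ^ 2" where "J = vector [vector [1, 0], vector [0, -1]]"
    have J: "det J = -1"
      by (simp add: det_2 J_def)
    have "?z (bcf_twist g1 J) = ?z g2"
      using that closed[OF disc(2)] by (simp add: twist[OF J])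
    moreover have "bcf_disc (bcf_twist g1 J) = \<Delta>"
      using disc(1) by (simp add: bcf_disc_twist J)
    ultimately obtain M where "det M = 1" "g2 = bcf_twist (bcf_twist g1 J) M"
      using cardano_invariant_eq_iff_twist[OF two three \<open>\<Delta> \<noteq> 0\<close> _ disc(2)] by blast
    then show ?thesis
      by (intro exI[of _ "M ** J"]) (simp add: det_mul J bcf_twist_twist)
  qed
  show "?z g1 = inv\<^bsub>?Q\<^esub> ?z g2" if "\<exists>M. det M = -1 \<and> g2 = bcf_twist g1 M"
    using that closed[OF disc(1)] twist by auto
qed

theorem theorem4p2:
  fixes \<Delta> :: "'a::field" and g1 g2 :: "'a bcf"
  assumes "CHAR('a) \<noteq> 2" and "CHAR('a) \<noteq> 3"
    and "\<Delta> \<noteq> 0"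
    and "bcf_disc g1 = \<Delta>" and "bcf_disc g2 = \<Delta>"
  shows "((\<exists>M :: 'a ^ 2 ^ 2. invertible M \<and> det M = 1 \<and> g2 = bcf_twist g1 M) \<longleftrightarrow>
            cardano_invariant \<Delta> g1 = cardano_invariant \<Delta> g2) \<and>
         ((\<exists>M :: 'a ^ 2 ^ 2. invertible M \<and> det M = - 1 \<and> g2 = bcf_twist g1 M) \<longleftrightarrow>
            cardano_invariant \<Delta> g1 = inv\<^bsub>units_mod_cubes \<Delta>\<^esub> (cardano_invariant \<Delta> g2)) \<and>
         ((\<exists>M :: 'a ^ 2 ^ 2. invertible M \<and> g2 = bcf_twist g1 M) \<longleftrightarrow>
            generate (units_mod_cubes \<Delta>) {cardano_invariant \<Delta> g1} =
            generate (units_mod_cubes \<Delta>) {cardano_invariant \<Delta> g2})"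
proof -
  interpret Q: comm_group "units_mod_cubes \<Delta>" by (rule comm_group_units_mod_cubes)
  have two: "(2::'a) \<noteq> 0" and three: "(3::'a) \<noteq> 0"
    using assms(1,2) of_nat_prime_eq_0_iff[of 2, where ?'a = 'a]
      of_nat_prime_eq_0_iff[of 3, where ?'a = 'a] by simp_all
  have "det M = 1 \<or> det M = -1" if "invertible M" "g2 = bcf_twist g1 M" for M :: "'a ^ 2 ^ 2"
    using that assms(3-5) by (auto simp: bcf_disc_twist invertible_det_nz power2_eq_1_iff)
  then have twist_iff: "(\<exists>M. invertible M \<and> g2 = bcf_twist g1 M) \<longleftrightarrow>
      (\<exists>M. det M = 1 \<and> g2 = bcf_twist g1 M) \<or> (\<exists>M. det M = -1 \<and> g2 = bcf_twist g1 M)"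
    by (metis invertible_det_nz neg_equal_0_iff_equal zero_neq_one)
  have det_iff: "invertible M \<and> det M = c \<and> P \<longleftrightarrow> det M = c \<and> P"
    if "c \<noteq> 0" for M :: "'a ^ 2 ^ 2" and c P
    using that by (auto simp: invertible_det_nz)
  note closed = cardano_invariant_closed[OF two three assms(3,5)]
  have generate_iff: "generate (units_mod_cubes \<Delta>) {cardano_invariant \<Delta> g1}
        = generate (units_mod_cubes \<Delta>) {cardano_invariant \<Delta> g2} \<longleftrightarrow>
      cardano_invariant \<Delta> g1 = cardano_invariant \<Delta> g2 \<or>
      cardano_invariant \<Delta> g1 = inv\<^bsub>units_mod_cubes \<Delta>\<^esub> cardano_invariant \<Delta> g2"
    by (intro Q.generate_singleton_eq_iff_if_pow_3_eq_one units_mod_cubes_pow_3 closed)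
  show ?thesis
    using two three assms(3-5)
    by (simp add: det_iff twist_iff generate_iff cardano_invariant_eq_iff_twist
        cardano_invariant_eq_inv_iff_twist)
qed

end
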